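(* Let $N\ge3$, let $u$ be a polynomial of degree at most $N+1$, let $x_1<\dots<x_N$ be the roots of $L_N-L_{N-2}$, and let $u_N$ be the polynomial of degree at most $N$ with $u_N(-1)=u(-1)$ and $u_N'(x_k)=u'(x_k)$ for $k=1,\dots,N$. Then there is a constant $c$ such that for all $x$ $$u(x) - u_N(x) = c\left[\frac{(x^2-1)(2N-1)L_{N-1}(x)}{N(N+1)} - \frac{4N-2}{N(N+1)(2N-3)} (L_{N-1}-L_{N-3})(x)\right].$$
   Context: $L_n$ denotes the Legendre polynomial of degree $n$ on $[-1,1]$, normalized by $L_n(1)=1$. *)

theory Defs
  imports "HOL-Analysis.Analysis" "HOL-Computational_Algebra.Polynomial"
begin

definition is_legendre :: "nat \<Rightarrow> real poly \<Rightarrow> bool" where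
  "is_legendre n p \<longleftrightarrow>
     degree p = n \<and>
     (\<forall>q. degree q < n \<longrightarrow> integral {-1..1} (\<lambda>t. poly p t * poly q t) = 0) \<and>
     poly p 1 = 1"

definition legendre :: "nat \<Rightarrow> real poly" where
  "legendre n = (THE p. is_legendre n p)"

lemma integrable_poly2: "(\<lambda>t. poly p t * poly q t) integrable_on {a..b::real}"
  by (intro integrable_continuous_real continuous_intros)

lemma integral_poly_square_eq_0:
  fixes p :: "real poly"
  assumes "integral {-1..1} (\<lambda>t. w t * (poly p t)^2) = 0"
    and w: "continuous_on {-1..1} w" "\<And>t. t \<in> {-1..1} \<Longrightarrow> w t \<ge> 0" "\<And>t. t \<in> {-1<..<1} \<Longrightarrow> w t > 0"
  shows "p = 0"
proof (rule ccontr)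
  assume "p \<noteq> 0"
  have c: "continuous_on {-1..1} (\<lambda>t. w t * (poly p t)^2)"
    by (intro continuous_intros w)
  have "(\<lambda>t. w t * (poly p t)^2) integrable_on {-1..1}"
    by (rule integrable_continuous_real[OF c])
  then have hi: "((\<lambda>t. w t * (poly p t)^2) has_integral 0) (cbox (-1) 1)"
    using assms(1) by (metis cbox_interval has_integral_integral)
  have z: "w t * (poly p t)^2 = 0" if "t \<in> {-1<..<1}" for t
    by (rule has_integral_0_cbox_imp_0[OF _ _ hi]) (use c w that in \<open>auto simp: box_real\<close>)
  then have "{-1<..<1} \<subseteq> {t. poly p t = 0}" using w(3) by fastforce
  then have "finite {-1<..<1::real}" using poly_roots_finite[OF \<open>p \<noteq> 0\<close>] finite_subset by blast
  then show False by (simp add: infinite_Ioo)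
qed

lemma integral_poly_by_parts:
  fixes f q :: "real poly"
  assumes "poly f 1 = 0" "poly f (-1) = 0"
  shows "integral {-1..1} (\<lambda>t. poly (pderiv f) t * poly q t)
       = - integral {-1..1} (\<lambda>t. poly f t * poly (pderiv q) t)"
proof -
  have "((\<lambda>t. poly (pderiv (f * q)) t) has_integral poly (f * q) 1 - poly (f * q) (-1)) {-1..1}"
    by (rule fundamental_theorem_of_calculus)
       (auto simp del: poly_mult
          intro!: has_real_derivative_iff_has_vector_derivative[THEN iffD1] DERIV_subset[OF poly_DERIV])
  then have "integral {-1..1} (\<lambda>t. poly (pderiv f) t * poly q t + poly f t * poly (pderiv q) t) = 0"
    using assms by (auto simp: pderiv_mult algebra_simps dest!: integral_unique)
  then show ?thesis
    by (subst (asm) integral_add) (auto intro: integrable_poly2)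
qed

lemma integral_higher_pderiv_eq_0:
  fixes f q :: "real poly"
  assumes "\<And>j. j < k \<Longrightarrow> poly ((pderiv ^^ j) f) 1 = 0 \<and> poly ((pderiv ^^ j) f) (-1) = 0"
    and "degree q < k"
  shows "integral {-1..1} (\<lambda>t. poly ((pderiv ^^ k) f) t * poly q t) = 0"
  using assms
proof (induction k arbitrary: q)
  case (Suc k)
  have eq: "integral {-1..1} (\<lambda>t. poly ((pderiv ^^ Suc k) f) t * poly q t)
     = - integral {-1..1} (\<lambda>t. poly ((pderiv ^^ k) f) t * poly (pderiv q) t)"
    using integral_poly_by_parts[of "(pderiv ^^ k) f" q] Suc.prems(1)[of k] by simp
  show ?case
  proof (cases "degree q = 0")
    case True
    then have "pderiv q = 0" by (simp add: pderiv_eq_0_iff)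
    then show ?thesis unfolding eq by simp
  next
    case False
    then have "degree (pderiv q) < k" using Suc.prems(2) by (simp add: degree_pderiv)
    then show ?thesis unfolding eq using Suc.IH[of "pderiv q"] Suc.prems(1) by simp
  qed
qed simp

lemma power_dvd_higher_pderiv:
  fixes g :: "real poly"
  assumes "j \<le> n"
  shows "g ^ (n - j) dvd (pderiv ^^ j) (g ^ n)"
  using assms
proof (induction j)
  case (Suc j)
  then obtain h where h: "(pderiv ^^ j) (g ^ n) = g ^ (n - j) * h" by (auto elim: dvdE)
  have "n - j = Suc (n - Suc j)" using Suc.prems by simp
  then have "g ^ (n - Suc j) dvd pderiv (g ^ (n - j) * h)"
    by (simp only: pderiv_mult pderiv_power_Suc) (intro dvd_add; simp add: dvd_smult)
  then show ?case using h by simp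
qed simp

lemma ex_legendre: "\<exists>p. is_legendre n p"
proof -
  define g :: "real poly" where "g = [:-1, 0, 1:]"
  define p where "p = (pderiv ^^ n) (g ^ n)"
  have orth: "integral {-1..1} (\<lambda>t. poly p t * poly q t) = 0" if "degree q < n" for q
    unfolding p_def
  proof (rule integral_higher_pderiv_eq_0[OF _ that])
    fix j assume j: "j < n"
    have "g dvd (pderiv ^^ j) (g ^ n)"
      using power_dvd_higher_pderiv[of j n g] j
      by (metis dvd_power dvd_trans less_imp_le zero_less_diff)
    then show "poly ((pderiv ^^ j) (g ^ n)) 1 = 0 \<and> poly ((pderiv ^^ j) (g ^ n)) (-1) = 0"
      by (auto simp: g_def elim!: dvdE)
  qed
  have deg: "degree p = n"
    by (simp add: p_def degree_higher_pderiv degree_power_eq g_def)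
  have nz: "poly p 1 \<noteq> 0"
  proof
    assume "poly p 1 = 0"
    then obtain r where r: "p = [:-1, 1:] * r"
      using poly_eq_0_iff_dvd[of p 1] by (auto elim: dvdE)
    have "r \<noteq> 0"
    proof
      assume "r = 0"
      then have "p = 0" using r by simp
      then have "n = 0" using deg by simp
      then show False using \<open>p = 0\<close> by (simp add: p_def)
    qed
    then have "degree p = Suc (degree r)" unfolding r by (subst degree_mult_eq) auto
    then have "degree r < n" using deg by simp
    then have "integral {-1..1} (\<lambda>t. - (poly p t * poly r t)) = 0"
      using orth by simp
    then have "integral {-1..1} (\<lambda>t. (1 - t) * (poly r t)^2) = 0"
      unfolding r by (simp add: algebra_simps power2_eq_square)
    then have "r = 0"
      by (rule integral_poly_square_eq_0) (auto intro!: continuous_intros)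
    then show False using \<open>r \<noteq> 0\<close> by simp
  qed
  have "is_legendre n (smult (inverse (poly p 1)) p)"
    using orth deg nz by (simp add: is_legendre_def mult.assoc)
  then show ?thesis ..
qed

lemma is_legendre_unique:
  assumes p: "is_legendre n p" and q: "is_legendre n q"
  shows "p = q"
proof -
  define a b where "a = lead_coeff p" and "b = lead_coeff q"
  define r where "r = smult b p - smult a q"
  have nz: "a \<noteq> 0" using p by (auto simp: a_def is_legendre_def)
  have "r = 0"
  proof (cases "n = 0")
    case True
    then show ?thesis using p q
      by (auto simp: r_def a_def b_def is_legendre_def elim!: degree_eq_zeroE)
  next
    case False
    have "degree r \<le> n" using p q
      by (auto simp: r_def is_legendre_def intro!: degree_diff_le order.trans[OF degree_smult_le])
    moreover have "coeff r n = 0"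
      using p q by (auto simp: r_def a_def b_def is_legendre_def)
    ultimately have d: "degree r < n"
      using False eq_zero_or_degree_less by fastforce
    have "integral {-1..1} (\<lambda>t. poly r t * poly r t)
        = integral {-1..1} (\<lambda>t. b * (poly p t * poly r t) - a * (poly q t * poly r t))"
      by (simp add: r_def algebra_simps)
    also have "\<dots> = b * integral {-1..1} (\<lambda>t. poly p t * poly r t)
        - a * integral {-1..1} (\<lambda>t. poly q t * poly r t)"
      by (subst integral_diff) (auto intro!: integrable_continuous_real continuous_intros)
    also have "\<dots> = 0" using p q d by (simp add: is_legendre_def)
    finally have "integral {-1..1} (\<lambda>t. 1 * (poly r t)^2) = 0"
      by (simp add: power2_eq_square)
    then show ?thesis by (rule integral_poly_square_eq_0) auto
  qed
  then have eq: "smult b p = smult a q" by (simp add: r_def)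
  then have "poly (smult b p) 1 = poly (smult a q) 1" by simp
  then have "a = b" using p q by (simp add: is_legendre_def)
  then show ?thesis using eq nz smult_cancel by blast
qed

lemma is_legendre_legendre: "is_legendre n (legendre n)"
  unfolding legendre_def by (rule theI', use ex_legendre is_legendre_unique in blast)

end

theory Submission
  imports Defs
begin

text \<open>
  Everything rests on one observation: if \<open>f\<close> has degree at most \<open>n + 1\<close>, vanishes at \<open>\<plusminus>1\<close> and is
  orthogonal to all polynomials of degree less than \<open>n - 1\<close>, then integrating by parts shows that
  \<open>f'\<close> is a multiple of \<open>L\<^sub>n\<close>. With \<open>n = N - 1\<close>, applying it to \<open>(x\<^sup>2 - 1) L\<^sub>n'\<close>, \<open>L\<^sub>n\<^sub>+\<^sub>1 - L\<^sub>n\<^sub>-\<^sub>1\<close> and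
  \<open>x L\<^sub>n - L\<^sub>n\<^sub>-\<^sub>1\<close> makes these three polynomials proportional, with ratios read off from values at 1,
  and the derivative of the bracket turns out to be exactly \<open>L\<^sub>N - L\<^sub>N\<^sub>-\<^sub>2\<close>. On the other hand \<open>u' - u\<^sub>N'\<close>
  has degree at most \<open>N\<close> and vanishes at the \<open>N\<close> roots of \<open>L\<^sub>N - L\<^sub>N\<^sub>-\<^sub>2\<close>, so it is a multiple of it.
\<close>

section \<open>Inner product on [-1, 1] and elementary facts on polynomials\<close>

definition ip :: "real poly \<Rightarrow> real poly \<Rightarrow> real" where
  "ip p q = integral {-1..1} (\<lambda>t. poly p t * poly q t)"

lemma ip_commute: "ip p q = ip q p"
  by (simp add: ip_def mult.commute)

lemma ip_diff_left: "ip (p - r) q = ip p q - ip r q"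
  unfolding ip_def poly_diff left_diff_distrib
  by (rule integral_diff; rule integrable_poly2)

lemma ip_smult_left: "ip (smult c p) q = c * ip p q"
  by (simp add: ip_def mult.assoc)

lemma ip_zero_right [simp]: "ip p 0 = 0"
  by (simp add: ip_def)

lemma ip_mult_shift: "ip (p * q) r = ip p (q * r)"
  by (simp add: ip_def mult.assoc)

lemma ip_self_eq_0: "ip p p = 0 \<Longrightarrow> p = 0"
  by (rule integral_poly_square_eq_0[where w = "\<lambda>_. 1"])
     (auto simp: ip_def power2_eq_square)

lemma ip_pderiv:
  "poly f 1 = 0 \<Longrightarrow> poly f (-1) = 0 \<Longrightarrow> ip (pderiv f) q = - ip f (pderiv q)"
  unfolding ip_def by (rule integral_poly_by_parts)

lemma ip_reflect: "ip (pcompose p [:0, -1:]) q = ip p (pcompose q [:0, -1:])"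
  using Henstock_Kurzweil_Integration.integral_reflect_real[of 1 "-1" "\<lambda>t. poly p t * poly q (- t)"]
  by (simp add: ip_def poly_pcompose)

lemma poly_eq_if_pderiv_eq:
  fixes p q :: "real poly"
  assumes "pderiv p = pderiv q" "poly p a = poly q a"
  shows "p = q"
proof -
  have "pderiv (p - q) = 0" using assms(1) by (simp add: pderiv_diff)
  then obtain c where "p - q = [:c:]"
    by (auto simp: pderiv_eq_0_iff elim: degree_eq_zeroE)
  moreover have "poly (p - q) a = 0" using assms(2) by simp
  ultimately show ?thesis by simp
qed

text \<open>The alternative \<open>p = 0\<close> covers \<open>n = 0\<close>, since the zero
  polynomial has degree 0.\<close>

lemma degree_le_coeff_0:
  "degree p \<le> n \<Longrightarrow> coeff p n = 0 \<Longrightarrow> p = 0 \<or> degree p < n"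
  using eq_zero_or_degree_less by blast

section \<open>Legendre polynomials: orthogonality and parity\<close>

lemma degree_legendre [simp]: "degree (legendre n) = n"
  and poly_legendre_1 [simp]: "poly (legendre n) 1 = 1"
  and ip_legendre: "degree q < n \<Longrightarrow> ip (legendre n) q = 0"
  using is_legendre_legendre[of n] by (auto simp: is_legendre_def ip_def)

lemma coeff_legendre_neq_0 [simp]: "coeff (legendre n) n \<noteq> 0"
  using leading_coeff_0_iff[of "legendre n"] poly_legendre_1[of n] by fastforce

text \<open>Cancelling the terms of degree \<open>n\<close> between \<open>q\<close> and L_n leaves
  \<open>s\<close> of degree below \<open>n\<close>, orthogonal to both and hence to itself. Since
  L_n(1) = 1, the factor is q(1).\<close>

lemma orthogonal_eq_smult_legendre:
  assumes "degree q \<le> n" and orth: "\<And>p. degree p < n \<Longrightarrow> ip q p = 0"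
  shows "q = smult (poly q 1) (legendre n)"
proof -
  define a where "a = coeff (legendre n) n"
  define s where "s = smult a q - smult (coeff q n) (legendre n)"
  have "degree s \<le> n" unfolding s_def using assms(1)
    by (intro degree_diff_le) (auto intro: order.trans[OF degree_smult_le])
  moreover have "coeff s n = 0" by (simp add: s_def a_def)
  ultimately have "s = 0 \<or> degree s < n" by (rule degree_le_coeff_0)
  moreover have "ip s s = 0" if "degree s < n"
  proof -
    have "ip s s = a * ip q s - coeff q n * ip (legendre n) s"
      by (subst s_def) (simp add: ip_diff_left ip_smult_left)
    then show ?thesis using that by (simp add: orth ip_legendre)
  qed
  ultimately have "s = 0" using ip_self_eq_0 by blast
  then have eq: "smult a q = smult (coeff q n) (legendre n)" by (simp add: s_def)
  then have "poly (smult a q) 1 = poly (smult (coeff q n) (legendre n)) 1" by simp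
  then have "coeff q n = a * poly q 1" by simp
  then have "smult a q = smult a (smult (poly q 1) (legendre n))" by (simp add: eq)
  then show ?thesis using coeff_legendre_neq_0[of n] by (metis a_def smult_cancel)
qed

lemma pderiv_eq_smult_legendre:
  assumes "degree f \<le> Suc n" "poly f 1 = 0" "poly f (-1) = 0"
    and orth: "\<And>p. Suc (degree p) < n \<Longrightarrow> ip f p = 0"
  shows "pderiv f = smult (poly (pderiv f) 1) (legendre n)"
proof (rule orthogonal_eq_smult_legendre)
  show "degree (pderiv f) \<le> n" using assms(1) by (simp add: degree_pderiv)
next
  fix p :: "real poly"
  assume p: "degree p < n"
  have "ip f (pderiv p) = 0"
  \<comment> \<open>For constant \<open>p\<close> the derivative is 0 and still has degree 0, so
    \<open>orth\<close> would not cover it when \<open>n = 1\<close>.\<close>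
  proof (cases "degree p = 0")
    case True
    then show ?thesis by (simp add: pderiv_eq_0_iff[THEN iffD2])
  next
    case False
    then show ?thesis using p by (intro orth) (simp add: degree_pderiv)
  qed
  then show "ip (pderiv f) p = 0" using assms by (simp add: ip_pderiv)
qed

text \<open>L_n(-x) inherits the orthogonality of L_n, so it is L_n(-1) times L_n; the leading
  coefficients then differ by (-1)^n.\<close>

lemma poly_legendre_minus_1: "poly (legendre n) (-1) = (-1) ^ n"
proof -
  let ?r = "[:0, -1:] :: real poly"
  have "pcompose (legendre n) ?r = smult (poly (pcompose (legendre n) ?r) 1) (legendre n)"
    by (rule orthogonal_eq_smult_legendre) (simp_all add: degree_pcompose ip_reflect ip_legendre)
  then have "lead_coeff (pcompose (legendre n) ?r)
      = coeff (smult (poly (legendre n) (-1)) (legendre n)) n"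
    by (simp add: poly_pcompose degree_pcompose)
  then show ?thesis by (subst (asm) lead_coeff_comp) auto
qed

section \<open>Differential equation and derivative formulas\<close>

lemma legendre_ode_poly:
  "pderiv ([:-1, 0, 1:] * pderiv (legendre n)) = smult (real n * (real n + 1)) (legendre n)"
proof (cases "n = 0")
  case True
  then have "pderiv (legendre n) = 0" by (simp add: pderiv_eq_0_iff)
  then show ?thesis using True by simp
next
  case False
  define f where "f = [:-1, 0, 1:] * pderiv (legendre n)"
  have f: "pderiv f = smult (poly (pderiv f) 1) (legendre n)"
  proof (rule pderiv_eq_smult_legendre)
    show "degree f \<le> Suc n"
      unfolding f_def using False by (intro order.trans[OF degree_mult_le]) (simp add: degree_pderiv)
    show "poly f 1 = 0" "poly f (-1) = 0" by (simp_all add: f_def)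
    fix p :: "real poly"
    assume p: "Suc (degree p) < n"
    \<comment> \<open>A further integration by parts moves the derivative from L_n to (x^2 - 1) p,
      and the result has degree below \<open>n\<close>.\<close>
    let ?g = "[:-1, 0, 1:] * p"
    have "degree ?g \<le> 2 + degree p" by (intro order.trans[OF degree_mult_le]) simp
    then have "ip (legendre n) (pderiv ?g) = 0"
      using p by (intro ip_legendre) (simp add: degree_pderiv)
    moreover have "ip f p = ip ?g (pderiv (legendre n))"
      by (simp only: f_def ip_def poly_mult mult_ac)
    moreover have "ip (pderiv ?g) (legendre n) = - ip ?g (pderiv (legendre n))"
      by (rule ip_pderiv) simp_all
    ultimately show "ip f p = 0" by (simp add: ip_commute)
  qed
  \<comment> \<open>The value of L_n' at 1 will itself be deduced from this equation, so the factor
    is found by comparing coefficients of x^n instead.\<close>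
  have "f = pCons 0 (pCons 0 (pderiv (legendre n))) - pderiv (legendre n)"
    by (simp add: f_def)
  then have "coeff f (Suc n) = real n * coeff (legendre n) n"
    using False by (cases n) (simp_all add: coeff_pderiv coeff_eq_0)
  then have "coeff (pderiv f) n = (real n * (real n + 1)) * coeff (legendre n) n"
    by (simp add: coeff_pderiv)
  moreover have "coeff (pderiv f) n = poly (pderiv f) 1 * coeff (legendre n) n"
    by (subst f) simp
  ultimately have "poly (pderiv f) 1 = real n * (real n + 1)" by simp
  then show ?thesis using f by (simp only: f_def)
qed

text \<open>At 1 only the term 2x L_n' survives on the left of the differential equation.\<close>

lemma poly_pderiv_legendre_1: "poly (pderiv (legendre n)) 1 = real n * (real n + 1) / 2"
  using arg_cong[OF legendre_ode_poly, of "\<lambda>p. poly p 1" n]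
  by (simp add: pderiv_mult pderiv_pCons pderiv_diff)

text \<open>Equal parity makes the difference vanish at -1 as well as at 1.\<close>

lemma pderiv_legendre_diff:
  "pderiv (legendre (n + 2) - legendre n) = smult (2 * real n + 3) (legendre (n + 1))"
proof -
  let ?f = "legendre (n + 2) - legendre n"
  have "pderiv ?f = smult (poly (pderiv ?f) 1) (legendre (n + 1))"
  proof (rule pderiv_eq_smult_legendre)
    show "degree ?f \<le> Suc (n + 1)" by (intro degree_diff_le) simp_all
  qed (simp_all add: poly_legendre_minus_1 ip_diff_left ip_legendre)
  moreover have "poly (pderiv ?f) 1 = 2 * real n + 3"
    by (simp add: pderiv_diff poly_pderiv_legendre_1 field_simps)
  ultimately show ?thesis by simp
qed

text \<open>Both sides vanish at 1 and have derivative (n+1)(n+2)(2n+3) L_{n+1}.\<close>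

lemma legendre_diff_eq:
  "smult ((real n + 1) * (real n + 2)) (legendre (n + 2) - legendre n)
    = smult (2 * real n + 3) ([:-1, 0, 1:] * pderiv (legendre (n + 1)))"
  by (rule poly_eq_if_pderiv_eq[where a = 1])
     (simp_all only: pderiv_smult pderiv_legendre_diff legendre_ode_poly, simp_all add: algebra_simps)

lemma pderiv_legendre_eq:
  "[:-1, 0, 1:] * pderiv (legendre (n + 1))
    = smult (real n + 1) ([:0, 1:] * legendre (n + 1) - legendre n)"
proof -
  let ?f = "[:0, 1:] * legendre (n + 1) - legendre n"
  have "pderiv ?f = smult (poly (pderiv ?f) 1) (legendre (n + 1))"
  proof (rule pderiv_eq_smult_legendre)
    show "degree ?f \<le> Suc (n + 1)"
      by (intro degree_diff_le order.trans[OF degree_mult_le]) simp_all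
    fix p :: "real poly"
    assume p: "Suc (degree p) < n + 1"
    \<comment> \<open>The factor x is moved onto \<open>p\<close>, whose degree stays below
      \<open>n + 1\<close>.\<close>
    have "ip (legendre (n + 1)) ([:0, 1:] * p) = 0"
      using p by (intro ip_legendre order.strict_trans1[OF degree_mult_le]) simp
    moreover have "ip ?f p = ip (legendre (n + 1)) ([:0, 1:] * p) - ip (legendre n) p"
      by (simp only: ip_diff_left mult.commute[of "[:0, 1:]" "legendre _"] ip_mult_shift)
    ultimately show "ip ?f p = 0" using p by (simp add: ip_legendre)
  qed (simp_all add: poly_legendre_minus_1)
  moreover have "poly (pderiv ?f) 1 = real n + 2"
    by (simp add: pderiv_diff pderiv_mult pderiv_pCons poly_pderiv_legendre_1 field_simps)
  ultimately have f: "pderiv ?f = smult (real n + 2) (legendre (n + 1))" by simp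
  \<comment> \<open>Both sides vanish at 1 and have derivative (n+1)(n+2) L_{n+1}.\<close>
  show ?thesis
    by (rule poly_eq_if_pderiv_eq[where a = 1])
       (simp_all only: pderiv_smult f legendre_ode_poly, simp_all add: algebra_simps)
qed

section \<open>Root counting, the bracket and the error formula\<close>

lemma eq_smult_if_same_roots:
  fixes p q :: "real poly"
  assumes "degree p \<le> n" "degree q = n" "card {t. poly q t = 0} = n"
    and q: "q \<noteq> 0" and roots: "\<And>t. poly q t = 0 \<Longrightarrow> poly p t = 0"
  shows "\<exists>k. p = smult k q"
proof -
  \<comment> \<open>The subtraction pushes the degree below \<open>n\<close> but keeps the
    \<open>n\<close> distinct roots of \<open>q\<close>, which forces \<open>r = 0\<close>.\<close>
  define r where "r = p - smult (coeff p n / lead_coeff q) q"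
  have "degree r \<le> n" unfolding r_def using assms
    by (intro degree_diff_le) (auto intro: order.trans[OF degree_smult_le])
  moreover have "coeff r n = 0" using assms(2) q by (auto simp: r_def)
  ultimately have deg: "r = 0 \<or> degree r < n" by (rule degree_le_coeff_0)
  have "r = 0"
  proof (rule ccontr)
    assume nz: "r \<noteq> 0"
    have "n \<le> card {t. poly r t = 0}"
      unfolding assms(3)[symmetric]
      by (rule card_mono) (use poly_roots_finite[OF nz] roots in \<open>auto simp: r_def\<close>)
    also have "\<dots> \<le> degree r" using nz by (rule card_poly_roots_bound)
    finally show False using deg nz by simp
  qed
  then show ?thesis by (auto simp: r_def)
qed

text \<open>With \<open>N = m + 3\<close>, \<open>a\<close> and \<open>b\<close> are the constants
  of the error formula. Both sides reduce to multiples of x L_{m+2} - L_{m+1}.\<close>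

lemma pderiv_bracket:
  fixes m :: nat
  defines "a \<equiv> (2 * real m + 5) / ((real m + 3) * (real m + 4))"
    and "b \<equiv> (4 * real m + 10) / ((real m + 3) * (real m + 4) * (2 * real m + 3))"
  shows "pderiv (smult a ([:-1, 0, 1:] * legendre (m + 2)) - smult b (legendre (m + 2) - legendre m))
    = legendre (m + 3) - legendre (m + 1)"
    (is "pderiv ?B = ?M")
proof -
  have "poly (pderiv ?B) t = poly ?M t" for t
  proof -
    define L where "L = poly (legendre (m + 2)) t"
    define K where "K = poly (legendre (m + 1)) t"
    define D where "D = poly ([:-1, 0, 1:] * pderiv (legendre (m + 2))) t"
    \<comment> \<open>The denominator of \<open>b\<close> absorbs the factor from differentiating
      L_{m+2} - L_m, so the resulting -2aK pairs with 2atL from the product rule.\<close>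
    have b: "b * (2 * real m + 3) = 2 * a" by (simp add: a_def b_def)
    have D: "D = (real m + 2) * (t * L - K)"
      using arg_cong[OF pderiv_legendre_eq[of "m + 1"], of "\<lambda>p. poly p t"]
      by (simp add: D_def L_def K_def algebra_simps)
    have M: "(real m + 2) * (real m + 3) * poly ?M t = (2 * real m + 5) * D"
      using arg_cong[OF legendre_diff_eq[of "m + 1"], of "\<lambda>p. poly p t"]
      by (simp add: D_def algebra_simps numeral_3_eq_3)
    have "poly (pderiv ?B) t = a * (2 * t * L + D) - b * ((2 * real m + 3) * K)"
      unfolding pderiv_diff[of "smult _ _"] pderiv_smult pderiv_legendre_diff
      by (simp add: D_def L_def K_def pderiv_mult pderiv_pCons pderiv_diff algebra_simps)
    also have "\<dots> = a * (2 * (t * L - K) + D)"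
      by (simp add: mult.assoc[symmetric] b) (simp add: algebra_simps)
    also have "\<dots> = a * (real m + 4) * (t * L - K)"
      by (simp add: D algebra_simps)
    also have "a * (real m + 4) = (2 * real m + 5) / (real m + 3)" by (simp add: a_def)
    also have "(2 * real m + 5) / (real m + 3) * (t * L - K)
        = (2 * real m + 5) * D / ((real m + 2) * (real m + 3))"
      by (simp add: D)
    also have "\<dots> = poly ?M t" unfolding M[symmetric] by simp
    finally show ?thesis .
  qed
  then show ?thesis by (intro poly_eq_poly_eq_iff[THEN iffD1] ext)
qed

theorem theorem3p2:
  fixes N :: nat and u u_N :: "real poly" and x :: "nat \<Rightarrow> real"
  assumes "N \<ge> 3"
    and "degree u \<le> N + 1"
    and "strict_mono_on {1..N} x"
    and "x ` {1..N} = {t. poly (legendre N - legendre (N - 2)) t = 0}"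
    and "degree u_N \<le> N"
    and "poly u_N (-1) = poly u (-1)"
    and "\<forall>k\<in>{1..N}. poly (pderiv u_N) (x k) = poly (pderiv u) (x k)"
  shows "\<exists>c. \<forall>t. poly u t - poly u_N t =
    c * ((t^2 - 1) * (2 * real N - 1) * poly (legendre (N - 1)) t / (real N * (real N + 1))
       - (4 * real N - 2) / (real N * (real N + 1) * (2 * real N - 3))
         * poly (legendre (N - 1) - legendre (N - 3)) t)"
proof -
  \<comment> \<open>This substitution removes the truncated subtractions from the indices.\<close>
  obtain m where N: "N = m + 3" using assms(1) by (metis add.commute le_Suc_ex)
  define M where "M = legendre (m + 3) - legendre (m + 1)"
  define B where "B = smult ((2 * real m + 5) / ((real m + 3) * (real m + 4)))
      ([:-1, 0, 1:] * legendre (m + 2))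
    - smult ((4 * real m + 10) / ((real m + 3) * (real m + 4) * (2 * real m + 3)))
      (legendre (m + 2) - legendre m)"
  have "coeff M N \<noteq> 0" by (simp add: M_def N coeff_eq_0)
  moreover have "degree M \<le> N" unfolding M_def N by (intro degree_diff_le) simp_all
  ultimately have M: "degree M = N" "M \<noteq> 0" using le_degree[of M N] by auto
  have roots: "{t. poly M t = 0} = x ` {1..N}" using assms(4) by (simp add: M_def N)
  have "inj_on x {1..N}" using assms(3) by (rule strict_mono_on_imp_inj_on)
  then have card: "card {t. poly M t = 0} = N" by (simp add: roots card_image)
  have "\<exists>k. pderiv (u - u_N) = smult k M"
  proof (rule eq_smult_if_same_roots[OF _ M(1) card M(2)])
    have "degree (u - u_N) \<le> N + 1" using assms(2,5) by (intro degree_diff_le) simp_all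
    then show "degree (pderiv (u - u_N)) \<le> N" by (simp add: degree_pderiv)
    fix t
    assume "poly M t = 0"
    then have "t \<in> x ` {1..N}" using roots by blast
    then show "poly (pderiv (u - u_N)) t = 0" using assms(7) by (auto simp: pderiv_diff)
  qed
  then obtain k where k: "pderiv (u - u_N) = smult k M" by blast
  have "pderiv B = M" unfolding B_def M_def by (rule pderiv_bracket)
  \<comment> \<open>This matches u_N(-1) = u(-1) and fixes the constant of integration; L_{N-1} and
    L_{N-3} agree at -1 by parity.\<close>
  moreover have "poly B (-1) = 0" by (simp add: B_def poly_legendre_minus_1)
  ultimately have "pderiv (u - u_N) = pderiv (smult k B)"
    and "poly (u - u_N) (-1) = poly (smult k B) (-1)"
    by (simp_all add: k pderiv_smult assms(6))
  then have "u - u_N = smult k B" by (rule poly_eq_if_pderiv_eq)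
  then have "poly u t - poly u_N t = k * poly B t" for t by (metis poly_diff poly_smult)
  moreover have "poly B t =
      (t^2 - 1) * (2 * real N - 1) * poly (legendre (N - 1)) t / (real N * (real N + 1))
       - (4 * real N - 2) / (real N * (real N + 1) * (2 * real N - 3))
         * poly (legendre (N - 1) - legendre (N - 3)) t" for t
    by (simp add: B_def N power2_eq_square algebra_simps)
  ultimately show ?thesis by metis
qed

end
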